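(* Let $T=(V,E)$ be a finite tree, $\mathcal{M}\in\{\mathcal{MIN},\mathcal{MAJ}\}$, $c\in\mathcal{C}^2_{\mathcal{M}}(T)$, and let $e=(u,w)$ be an edge of the block tree $\mathcal{B}_c(T)$. Then: (1) if $\deg_T(u)=2$ then $u$ is a fixed node of $c$; (2) $\min(\deg_T(u),\deg_T(w))\ge 2$ and $\max(\deg_T(u),\deg_T(w))\ge 3$; (3) if $T_0$ is a node of $\mathcal{B}_c(T)$, $v\in T_0$, $\deg_{T_0}(v)=1$ and $\deg_T(v)$ is even, then $v$ is a fixed node and $T_0$ is a fixed block; (4) if $T_0=\{v\}$ is a node of $\mathcal{B}_c(T)$ then $v$ is a fixed node, $T_0$ is a fixed block, and $\deg_T(v)$ is even.
   Context: Colorings are maps $c:V\to\{0,1\}$; $N^i(v)$ is the set of neighbors of $v$ with color $i$. $\mathcal{MIN}(c)(v)=c(v)$ if $|N^{c(v)}(v)|\le|N^{1-c(v)}(v)|$, else $1-c(v)$; $\mathcal{MAJ}(c)(v)=c(v)$ if $|N^{c(v)}(v)|\ge|N^{1-c(v)}(v)|$, else $1-c(v)$ (simultaneous update). $\mathcal{C}^2_{\mathcal{M}}(T)$ is the set of colorings $c$ with $\mathcal{M}(c)\ne c$ and $\mathcal{M}(\mathcal{M}(c))=c$. For such $c$, a node $u$ is a fixed node if $\mathcal{M}(c)(u)=c(u)$ and a toggle node otherwise. $T^f$ (resp. $T^t$) is the subgraph of $T$ induced by the fixed (resp. toggle) nodes. The block tree $\mathcal{B}_c(T)$ has as nodes the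 connected components $T_1,\dots,T_s$ of $T^f$ and of $T^t$; $T_i$ and $T_j$ are adjacent iff some edge $(x,y)\in E$ has $x\in T_i$, $y\in T_j$, and this edge of $T$ is identified with the corresponding edge of $\mathcal{B}_c(T)$. A node of $\mathcal{B}_c(T)$ is a fixed block if it is a component of $T^f$ and a toggle block if it is a component of $T^t$. $\deg_{T_0}(v)$ denotes the degree of $v$ in the subtree $T_0$. *)

theory Defs
  imports "Graph_Theory.Graph_Theory" "HOL-Library.FuncSet"
begin

(* A finite simple undirected graph is a pair_graph, i.e. a finite, loop-free, symmetric digraph:
   every undirected edge {u,v} is represented by the two arcs (u,v) and (v,u).  Accordingly the
   undirected degree of v is its out_degree.

   The constants forest and tree of Digraph_Component are of no use here: their cycle includes the
   closed walk u, v, u along the two arcs of a single edge, so a symmetric digraph satisfies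
   forest only if it has no edges.  Closed walks of length at least 3 with pairwise distinct
   vertices are exactly the cycles of the undirected graph. *)
locale undirected_tree = pair_graph T for T :: "'a pair_pre_digraph" +
  assumes tree_connected: "connected (with_proj T)"
    and tree_acyclic: "\<not> (\<exists>p. pre_digraph.cycle (with_proj T) p \<and> 3 \<le> length p)"

definition connected_components :: "('a, 'b) pre_digraph \<Rightarrow> ('a, 'b) pre_digraph set" where
  "connected_components G = {H. pre_digraph.max_subgraph G connected H}"

definition colorings :: "'a pair_pre_digraph \<Rightarrow> ('a \<Rightarrow> nat) set" where
  "colorings T = pverts T \<rightarrow>\<^sub>E {0, 1}"

definition nbrs_col :: "'a pair_pre_digraph \<Rightarrow> ('a \<Rightarrow> nat) \<Rightarrow> nat \<Rightarrow> 'a \<Rightarrow> 'a set" where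
  "nbrs_col T c i v = {w. (v, w) \<in> parcs T \<and> c w = i}"

definition min_process :: "'a pair_pre_digraph \<Rightarrow> ('a \<Rightarrow> nat) \<Rightarrow> 'a \<Rightarrow> nat" where
  "min_process T c = (\<lambda>v\<in>pverts T.
     if card (nbrs_col T c (c v) v) \<le> card (nbrs_col T c (1 - c v) v) then c v else 1 - c v)"

definition maj_process :: "'a pair_pre_digraph \<Rightarrow> ('a \<Rightarrow> nat) \<Rightarrow> 'a \<Rightarrow> nat" where
  "maj_process T c = (\<lambda>v\<in>pverts T.
     if card (nbrs_col T c (c v) v) \<ge> card (nbrs_col T c (1 - c v) v) then c v else 1 - c v)"

(* In the definitions below, M is the update rule of the process, i.e. min_process T or maj_process T. *)

definition two_cycles ::
    "'a pair_pre_digraph \<Rightarrow> (('a \<Rightarrow> nat) \<Rightarrow> 'a \<Rightarrow> nat) \<Rightarrow> ('a \<Rightarrow> nat) set" where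
  "two_cycles T M = {c \<in> colorings T. M c \<noteq> c \<and> M (M c) = c}"

definition fixed_nodes ::
    "'a pair_pre_digraph \<Rightarrow> (('a \<Rightarrow> nat) \<Rightarrow> 'a \<Rightarrow> nat) \<Rightarrow> ('a \<Rightarrow> nat) \<Rightarrow> 'a set" where
  "fixed_nodes T M c = {u \<in> pverts T. M c u = c u}"

definition toggle_nodes ::
    "'a pair_pre_digraph \<Rightarrow> (('a \<Rightarrow> nat) \<Rightarrow> 'a \<Rightarrow> nat) \<Rightarrow> ('a \<Rightarrow> nat) \<Rightarrow> 'a set" where
  "toggle_nodes T M c = {u \<in> pverts T. M c u \<noteq> c u}"

definition fixed_blocks ::
    "'a pair_pre_digraph \<Rightarrow> (('a \<Rightarrow> nat) \<Rightarrow> 'a \<Rightarrow> nat) \<Rightarrow> ('a \<Rightarrow> nat) \<Rightarrow>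
     ('a, 'a \<times> 'a) pre_digraph set" where
  "fixed_blocks T M c = connected_components (with_proj T \<restriction> fixed_nodes T M c)"

definition toggle_blocks ::
    "'a pair_pre_digraph \<Rightarrow> (('a \<Rightarrow> nat) \<Rightarrow> 'a \<Rightarrow> nat) \<Rightarrow> ('a \<Rightarrow> nat) \<Rightarrow>
     ('a, 'a \<times> 'a) pre_digraph set" where
  "toggle_blocks T M c = connected_components (with_proj T \<restriction> toggle_nodes T M c)"

definition block_tree ::
    "'a pair_pre_digraph \<Rightarrow> (('a \<Rightarrow> nat) \<Rightarrow> 'a \<Rightarrow> nat) \<Rightarrow> ('a \<Rightarrow> nat) \<Rightarrow>
     ('a, 'a \<times> 'a) pre_digraph pair_pre_digraph" where
  "block_tree T M c =
     (let \<B> = fixed_blocks T M c \<union> toggle_blocks T M c in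
      \<lparr> pverts = \<B>,
        parcs = {(B, B'). B \<in> \<B> \<and> B' \<in> \<B> \<and> B \<noteq> B' \<and>
                   (\<exists>x\<in>verts B. \<exists>y\<in>verts B'. (x, y) \<in> parcs T)} \<rparr>)"

(* The edges of T that are identified with an edge of the block tree. *)
definition block_tree_edges ::
    "'a pair_pre_digraph \<Rightarrow> (('a \<Rightarrow> nat) \<Rightarrow> 'a \<Rightarrow> nat) \<Rightarrow> ('a \<Rightarrow> nat) \<Rightarrow> ('a \<times> 'a) set" where
  "block_tree_edges T M c =
     {(x, y) \<in> parcs T. \<exists>(B, B') \<in> parcs (block_tree T M c). x \<in> verts B \<and> y \<in> verts B'}"

end

theory Submission
  imports Defs
begin

text \<open>
  Split the neighbours of a node \<open>v\<close> into fixed and toggle nodes and by colour: let \<open>a\<close> fixed and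
  \<open>p\<close> toggle neighbours have the colour of \<open>v\<close> (for the majority process: the other colour), and
  let \<open>b\<close> and \<open>q\<close> count the remaining ones. In the second phase of the two-cycle \<open>p\<close> and \<open>q\<close>
  trade places if \<open>v\<close> is fixed, and \<open>a\<close> and \<open>b\<close> do if \<open>v\<close> toggles. Applying the update rule in
  both phases gives \<open>b - a \<ge> \<bar>p - q\<bar>\<close> for a fixed node and \<open>p - q > \<bar>a - b\<bar>\<close> for a toggle node.
  All four claims are arithmetic consequences, because an edge between two blocks joins a fixed node
  to a toggle node and the degree of \<open>v\<close> in its block counts the neighbours of its own kind.
\<close>

section \<open>Connected components\<close>

text \<open>A common vertex \<open>x\<close> serves as hub: each vertex of either graph reaches
  \<open>x\<close> and is reached from it inside its own graph, and these walks survive in the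
  union.\<close>

lemma connected_union_non_disj:
  assumes "connected G" "connected H" "compatible G H" "verts G \<inter> verts H \<noteq> {}"
  shows "connected (union G H)"
proof -
  let ?U = "union G H"
  let ?R = "rtrancl_on (verts ?U) ((arcs_ends ?U)\<^sup>s)"
  have ends: "arcs_ends ?U = arcs_ends G \<union> arcs_ends H"
    using assms(3) by (auto simp: arcs_ends_conv compatible_tail compatible_head)
  have mono: "rtrancl_on (verts K) ((arcs_ends K)\<^sup>s) \<subseteq> ?R" if "K \<in> {G, H}" for K
    using that by (intro subrelI, elim rtrancl_on_mono[rotated 2]) (auto simp: ends symcl_def)
  obtain x where x: "x \<in> verts G" "x \<in> verts H" using assms(4) by blast
  have "(y, x) \<in> ?R \<and> (x, y) \<in> ?R" if "y \<in> verts ?U" for y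
    using that x assms(1,2) mono[of G] mono[of H] by (auto simp: connected_conv)
  then show ?thesis
    using x by (auto simp: connected_conv intro: rtrancl_on_trans)
qed

text \<open>The union of \<open>H\<close> and \<open>K\<close> is a connected subgraph of
  \<open>G\<close> containing \<open>H\<close>, so by maximality it is \<open>H\<close>
  itself.\<close>

lemma subgraph_connected_component:
  assumes H: "H \<in> connected_components G"
    and K: "subgraph K G" "connected K" "verts K \<inter> verts H \<noteq> {}"
  shows "subgraph K H"
proof -
  have max: "pre_digraph.max_subgraph G connected H"
    using H by (simp add: connected_components_def)
  have HG: "subgraph H G" "connected H"
    using max by (auto simp: pre_digraph.max_subgraph_def)
  have comp: "compatible H K"
    using HG(1) K(1) by (auto simp: subgraph_def compatible_def)
  have wf: "wf_digraph (union H K)"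
    using HG(1) K(1) comp by (intro wellformed_union) (auto simp: subgraph_def)
  have "connected (union H K)"
    using connected_union_non_disj[OF HG(2) K(2) comp] K(3) by blast
  moreover have "subgraph H (union H K)" "subgraph (union H K) G"
    using HG(1) K(1) wf by (auto simp: subgraph_def compatible_def)
  ultimately have "union H K = H"
    using max by (auto simp: pre_digraph.max_subgraph_def)
  moreover have "subgraph K (union H K)"
    using HG(1) K(1) wf by (auto simp: subgraph_def compatible_def)
  ultimately show ?thesis by simp
qed

lemma connected_components_eqI:
  assumes "H \<in> connected_components G" "K \<in> connected_components G" "verts H \<inter> verts K \<noteq> {}"
  shows "H = K"
proof -
  have "subgraph H K" "subgraph K H"
    using assms subgraph_connected_component[of H G K] subgraph_connected_component[of K G H]
    by (auto simp: connected_components_def pre_digraph.max_subgraph_def)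
  then show ?thesis
    by (intro pre_digraph.equality) (auto simp: subgraph_def compatible_def)
qed

text \<open>A single arc with its two ends is a connected graph. If it starts in \<open>H\<close>,
  it meets \<open>H\<close> and is therefore absorbed by it. Hence degrees in a block can be
  computed in the induced subgraph.\<close>

lemma connected_component_out_arcs:
  assumes H: "H \<in> connected_components G" and v: "v \<in> verts H"
  shows "out_arcs H v = out_arcs G v"
proof
  have HG: "subgraph H G"
    using H by (auto simp: connected_components_def pre_digraph.max_subgraph_def)
  then show "out_arcs H v \<subseteq> out_arcs G v"
    by (auto simp: subgraph_def compatible_def)
  show "out_arcs G v \<subseteq> out_arcs H v"
  proof
    fix e assume e: "e \<in> out_arcs G v"
    define K where "K = \<lparr>verts = {tail G e, head G e}, arcs = {e}, tail = tail G, head = head G\<rparr>"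
    have "wf_digraph K" by unfold_locales (auto simp: K_def)
    then have sub: "subgraph K G"
      using e HG by (auto simp: K_def subgraph_def compatible_def wf_digraph_def)
    have "connected K"
      by (auto simp: connected_conv K_def arcs_ends_conv symcl_def
          intro: rtrancl_consistent_rtrancl_on)
    then have "subgraph K H"
      using subgraph_connected_component[OF H sub] e v by (auto simp: K_def)
    then show "e \<in> out_arcs H v"
      using e by (auto simp: K_def subgraph_def compatible_def)
  qed
qed

section \<open>Local balance in a two-cycle\<close>

text \<open>This merges both processes into one rule: a node changes colour exactly when its
  neighbours of colour \<sigma> (d v) outnumber the others. For the minority process \<sigma> is the
  identity, for the majority process it swaps the colours. The swap \<open>1 - i\<close> is an
  involution only on 0 and 1, since subtraction on naturals truncates.\<close>

lemma update_rule:
  assumes "M \<in> {min_process T, maj_process T}"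
  shows "\<exists>\<sigma>\<in>{\<lambda>i. i, \<lambda>i. 1 - i}. \<forall>d v. v \<in> pverts T \<longrightarrow> d v \<in> {0, 1} \<longrightarrow>
    M d v = (if card (nbrs_col T d (\<sigma> (d v)) v) \<le> card (nbrs_col T d (1 - \<sigma> (d v)) v)
             then d v else 1 - d v)"
proof (cases "M = min_process T")
  case True
  then show ?thesis by (intro bexI[of _ "\<lambda>i. i"]) (auto simp: min_process_def)
next
  case False
  then have "M = maj_process T" using assms by blast
  then show ?thesis by (intro bexI[of _ "\<lambda>i. 1 - i"]) (auto simp: maj_process_def)
qed

abbreviation nbrs_in :: "'a pair_pre_digraph \<Rightarrow> 'a set \<Rightarrow> 'a \<Rightarrow> 'a set" where
  "nbrs_in T S v \<equiv> {w \<in> S. (v, w) \<in> parcs T}"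

lemma two_cycle_balance:
  assumes T: "pair_fin_digraph T"
    and M: "M \<in> {min_process T, maj_process T}"
    and c: "c \<in> two_cycles T M"
    and v: "v \<in> pverts T"
  obtains a b p q :: nat where
    "card (nbrs_in T (fixed_nodes T M c) v) = a + b"
    "card (nbrs_in T (toggle_nodes T M c) v) = p + q"
    "v \<in> fixed_nodes T M c \<Longrightarrow> a + p \<le> b + q \<and> a + q \<le> b + p"
    "v \<in> toggle_nodes T M c \<Longrightarrow> b + q < a + p \<and> a + q < b + p"
proof -
  interpret pair_fin_digraph T by fact
  obtain \<sigma> where \<sigma>: "\<sigma> \<in> {\<lambda>i. i, \<lambda>i. 1 - i}"
    and "\<forall>d v. v \<in> pverts T \<longrightarrow> d v \<in> {0, 1} \<longrightarrow>
      M d v = (if card (nbrs_col T d (\<sigma> (d v)) v) \<le> card (nbrs_col T d (1 - \<sigma> (d v)) v)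
               then d v else 1 - d v)"
    using update_rule[OF M] unfolding Bex_def by blast
  then have rule: "M d x =
      (if card (nbrs_col T d (\<sigma> (d x)) x) \<le> card (nbrs_col T d (1 - \<sigma> (d x)) x)
       then d x else 1 - d x)" if "x \<in> pverts T" "d x \<in> {0, 1}" for d x
    using that by blast
  have col: "c w \<in> {0, 1}" if "w \<in> pverts T" for w
    using c that unfolding two_cycles_def colorings_def by blast
  have col': "M c w \<in> {0, 1}" if "w \<in> pverts T" for w
    using rule[of w c, OF that col[OF that]] col[OF that] by auto
  have periodic: "M (M c) = c" using c by (simp add: two_cycles_def)
  \<comment> \<open>\<open>j\<close> is the colour whose strict majority among the neighbours makes
    \<open>v\<close> change in the first phase. The numbers \<open>a\<close>, \<open>p\<close> will
    count neighbours of colour \<open>j\<close>, and \<open>b\<close>, \<open>q\<close> those of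
    colour \<open>1 - j\<close>.\<close>
  define j where "j = \<sigma> (c v)"
  have j: "j \<in> {0, 1}" using \<sigma> col[OF v] by (auto simp: j_def)
  define C where "C S k = {w \<in> nbrs_in T S v. c w = k}" for S k
  let ?F = "fixed_nodes T M c" and ?G = "toggle_nodes T M c"
  have fin: "finite (C S k)" for S k
    by (rule finite_subset[OF _ pair_finite_verts]) (auto simp: C_def wellformed')
  have split: "card (nbrs_in T S v) = card (C S j) + card (C S (1 - j))"
    if "S \<subseteq> pverts T" for S
  proof -
    have "nbrs_in T S v = C S j \<union> C S (1 - j)"
      using that col j by (fastforce simp: C_def)
    moreover have "C S j \<inter> C S (1 - j) = {}" using j by (auto simp: C_def)
    ultimately show ?thesis using fin by (simp add: card_Un_disjoint)
  qed
  have disj: "C ?F k \<inter> C ?G l = {}" for k l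
    by (auto simp: C_def fixed_nodes_def toggle_nodes_def)
  have phase1: "card (nbrs_col T c k v) = card (C ?F k) + card (C ?G k)" for k
  proof -
    have "nbrs_col T c k v = C ?F k \<union> C ?G k"
      by (auto simp: nbrs_col_def C_def fixed_nodes_def toggle_nodes_def wellformed')
    then show ?thesis using fin disj by (simp add: card_Un_disjoint)
  qed
  \<comment> \<open>After one update the fixed neighbours keep their colour, while a toggle
    neighbour has colour \<open>k\<close> exactly if it had the opposite colour before.\<close>
  have phase2: "card (nbrs_col T (M c) k v) = card (C ?F k) + card (C ?G (1 - k))"
    if k: "k \<in> {0, 1}" for k
  proof -
    have flip: "w \<in> nbrs_col T (M c) k v \<longleftrightarrow> w \<in> C ?F k \<union> C ?G (1 - k)" if "w \<in> pverts T" for w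
    proof (cases "M c w = c w")
      case True
      then show ?thesis
        using that by (simp add: nbrs_col_def C_def fixed_nodes_def toggle_nodes_def)
    next
      case False
      then have "M c w = k \<longleftrightarrow> c w = 1 - k" using k col[OF that] col'[OF that] by auto
      with False show ?thesis
        using that by (simp add: nbrs_col_def C_def fixed_nodes_def toggle_nodes_def)
    qed
    have "nbrs_col T (M c) k v \<union> C ?F k \<union> C ?G (1 - k) \<subseteq> pverts T"
      by (auto simp: nbrs_col_def C_def wellformed')
    with flip have "nbrs_col T (M c) k v = C ?F k \<union> C ?G (1 - k)" by blast
    then show ?thesis using fin disj by (simp add: card_Un_disjoint)
  qed
  have jj: "1 - j \<in> {0, 1}" "1 - (1 - j) = j" using j by auto
  have r1: "M c v = (if card (nbrs_col T c j v) \<le> card (nbrs_col T c (1 - j) v)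
      then c v else 1 - c v)"
    using rule[of v c, OF v col[OF v]] by (simp add: j_def)
  \<comment> \<open>The rule is applied to \<open>M c\<close>; periodicity turns its left-hand side
    \<open>M (M c) v\<close> into \<open>c v\<close>.\<close>
  have r2: "c v = (if card (nbrs_col T (M c) (\<sigma> (M c v)) v)
        \<le> card (nbrs_col T (M c) (1 - \<sigma> (M c v)) v)
      then M c v else 1 - M c v)"
    using rule[of v "M c", OF v] col'[OF v] periodic by simp
  show ?thesis
  proof (rule that[of "card (C ?F j)" "card (C ?F (1 - j))" "card (C ?G j)" "card (C ?G (1 - j))"])
    show "card (nbrs_in T ?F v) = card (C ?F j) + card (C ?F (1 - j))"
      by (rule split) (auto simp: fixed_nodes_def)
    show "card (nbrs_in T ?G v) = card (C ?G j) + card (C ?G (1 - j))"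
      by (rule split) (auto simp: toggle_nodes_def)
  next
    assume "v \<in> ?F"
    then have eq: "M c v = c v" by (simp add: fixed_nodes_def)
    have "card (nbrs_col T c j v) \<le> card (nbrs_col T c (1 - j) v)"
      using r1 col[OF v] unfolding eq by (auto split: if_splits)
    moreover have "card (nbrs_col T (M c) j v) \<le> card (nbrs_col T (M c) (1 - j) v)"
      using r2 col[OF v] unfolding eq j_def[symmetric] by (auto split: if_splits)
    ultimately show "card (C ?F j) + card (C ?G j) \<le> card (C ?F (1 - j)) + card (C ?G (1 - j))
        \<and> card (C ?F j) + card (C ?G (1 - j)) \<le> card (C ?F (1 - j)) + card (C ?G j)"
      using phase1 phase2[OF j] phase2[OF jj(1)] jj(2) by simp
  next
    assume "v \<in> ?G"
    then have neq: "M c v \<noteq> c v" by (simp add: toggle_nodes_def)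
    \<comment> \<open>A toggle node enters the second phase with the opposite colour, so
      \<open>j\<close> and \<open>1 - j\<close> exchange roles. It changes in both phases, which
      makes both inequalities strict.\<close>
    then have "\<sigma> (M c v) = 1 - j"
      using \<sigma> col[OF v] col'[OF v] by (auto simp: j_def)
    then have "card (nbrs_col T (M c) j v) < card (nbrs_col T (M c) (1 - j) v)"
      using r2 neq jj(2) by (auto split: if_splits)
    moreover have "card (nbrs_col T c (1 - j) v) < card (nbrs_col T c j v)"
      using r1 neq by (auto split: if_splits)
    ultimately show "card (C ?F (1 - j)) + card (C ?G (1 - j)) < card (C ?F j) + card (C ?G j)
        \<and> card (C ?F j) + card (C ?G (1 - j)) < card (C ?F (1 - j)) + card (C ?G j)"
      using phase1 phase2[OF j] phase2[OF jj(1)] jj(2) by simp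
  qed
qed

section \<open>Blocks and degrees\<close>

lemma out_degree_with_proj: "out_degree (with_proj T) v = card {w. (v, w) \<in> parcs T}"
proof -
  have "out_arcs (with_proj T) v = Pair v ` {w. (v, w) \<in> parcs T}"
    by auto
  then show ?thesis by (simp add: out_degree_def card_image inj_on_def)
qed

lemma out_degree_fixed_toggle:
  assumes "pair_fin_digraph T"
  shows "out_degree (with_proj T) v
    = card (nbrs_in T (fixed_nodes T M c) v) + card (nbrs_in T (toggle_nodes T M c) v)"
proof -
  interpret pair_fin_digraph T by fact
  let ?N = "\<lambda>S. nbrs_in T S v"
  have "finite (?N S)" if "S \<subseteq> pverts T" for S
    by (rule finite_subset[OF _ pair_finite_verts]) (use that in blast)
  then have "finite (?N (fixed_nodes T M c))" "finite (?N (toggle_nodes T M c))"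
    by (simp_all add: fixed_nodes_def toggle_nodes_def)
  moreover have "?N (fixed_nodes T M c) \<inter> ?N (toggle_nodes T M c) = {}"
    by (auto simp: fixed_nodes_def toggle_nodes_def)
  ultimately have "card (?N (fixed_nodes T M c) \<union> ?N (toggle_nodes T M c))
    = card (?N (fixed_nodes T M c)) + card (?N (toggle_nodes T M c))"
    by (rule card_Un_disjoint)
  moreover have "{w. (v, w) \<in> parcs T} = ?N (fixed_nodes T M c) \<union> ?N (toggle_nodes T M c)"
    by (auto simp: fixed_nodes_def toggle_nodes_def wellformed')
  ultimately show ?thesis by (simp only: out_degree_with_proj)
qed

lemma two_cycle_fixed_balance:
  assumes "pair_fin_digraph T"
    and "M \<in> {min_process T, maj_process T}"
    and "c \<in> two_cycles T M"
    and v: "v \<in> fixed_nodes T M c"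
  obtains a b p q :: nat where
    "card (nbrs_in T (fixed_nodes T M c) v) = a + b"
    "card (nbrs_in T (toggle_nodes T M c) v) = p + q"
    "out_degree (with_proj T) v = a + b + (p + q)"
    "a + p \<le> b + q" "a + q \<le> b + p"
proof -
  have "v \<in> pverts T" using v by (simp add: fixed_nodes_def)
  from assms(1-3) this show ?thesis
  proof (rule two_cycle_balance)
    fix a b p q
    assume F: "card (nbrs_in T (fixed_nodes T M c) v) = a + b"
      and G: "card (nbrs_in T (toggle_nodes T M c) v) = p + q"
      and "v \<in> fixed_nodes T M c \<Longrightarrow> a + p \<le> b + q \<and> a + q \<le> b + p"
    with v have "a + p \<le> b + q" "a + q \<le> b + p" by simp_all
    with F G show ?thesis
      using out_degree_fixed_toggle[OF assms(1), of v M c] by (intro that) simp_all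
  qed
qed

lemma two_cycle_toggle_balance:
  assumes "pair_fin_digraph T"
    and "M \<in> {min_process T, maj_process T}"
    and "c \<in> two_cycles T M"
    and v: "v \<in> toggle_nodes T M c"
  obtains a b p q :: nat where
    "card (nbrs_in T (fixed_nodes T M c) v) = a + b"
    "card (nbrs_in T (toggle_nodes T M c) v) = p + q"
    "out_degree (with_proj T) v = a + b + (p + q)"
    "b + q < a + p" "a + q < b + p"
proof -
  have "v \<in> pverts T" using v by (simp add: toggle_nodes_def)
  from assms(1-3) this show ?thesis
  proof (rule two_cycle_balance)
    fix a b p q
    assume F: "card (nbrs_in T (fixed_nodes T M c) v) = a + b"
      and G: "card (nbrs_in T (toggle_nodes T M c) v) = p + q"
      and "v \<in> toggle_nodes T M c \<Longrightarrow> b + q < a + p \<and> a + q < b + p"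
    with v have "b + q < a + p" "a + q < b + p" by simp_all
    with F G show ?thesis
      using out_degree_fixed_toggle[OF assms(1), of v M c] by (intro that) simp_all
  qed
qed

section \<open>Blocks as components of induced subgraphs\<close>

lemma induced_component_verts:
  assumes "B \<in> connected_components (with_proj T \<restriction> S)"
  shows "verts B \<subseteq> S"
  using assms
  by (auto simp: connected_components_def pre_digraph.max_subgraph_def subgraph_def)

lemma induced_component_out_arcs:
  assumes "B \<in> connected_components (with_proj T \<restriction> S)" and "v \<in> verts B"
  shows "out_arcs B v = Pair v ` nbrs_in T S v"
  using connected_component_out_arcs[OF assms] induced_component_verts[OF assms(1)] assms(2)
  by auto

lemma induced_component_out_degree:
  assumes "B \<in> connected_components (with_proj T \<restriction> S)" and "v \<in> verts B"
  shows "out_degree B v = card (nbrs_in T S v)"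
  using induced_component_out_arcs[OF assms]
  by (simp add: out_degree_def card_image inj_on_def)

text \<open>A component contains every arc of the induced subgraph that leaves one of its vertices,
  so \<open>y\<close> lies in both components. Thus distinct blocks of the same kind are never
  adjacent.\<close>

lemma induced_component_adjacent:
  assumes B: "B \<in> connected_components (with_proj T \<restriction> S)"
    and B': "B' \<in> connected_components (with_proj T \<restriction> S)"
    and "x \<in> verts B" "y \<in> verts B'" "(x, y) \<in> parcs T"
  shows "B = B'"
proof -
  have "y \<in> S" using induced_component_verts[OF B'] assms(4) by blast
  then have "(x, y) \<in> out_arcs B x"
    using induced_component_out_arcs[OF B assms(3)] assms(5) by auto
  moreover have "wf_digraph B" "head B = snd"
    using B by (auto simp: connected_components_def pre_digraph.max_subgraph_def
        subgraph_def compatible_def)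
  ultimately have "y \<in> verts B"
    using wf_digraph.head_in_verts[of B "(x, y)"] by simp
  then show ?thesis
    using connected_components_eqI[OF B B'] assms(4) by blast
qed

text \<open>The degree inside a block becomes one of the two counts of the balance inequalities:
  \<open>a + b\<close> in a fixed block, \<open>p + q\<close> in a toggle block.\<close>

lemma block_cases:
  assumes "B \<in> pverts (block_tree T M c)" and "v \<in> verts B"
  obtains "B \<in> fixed_blocks T M c" "v \<in> fixed_nodes T M c"
      "out_degree B v = card (nbrs_in T (fixed_nodes T M c) v)"
    | "B \<in> toggle_blocks T M c" "v \<in> toggle_nodes T M c"
      "out_degree B v = card (nbrs_in T (toggle_nodes T M c) v)"
proof -
  from assms(1) consider "B \<in> fixed_blocks T M c" | "B \<in> toggle_blocks T M c"
    by (auto simp: block_tree_def)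
  then show ?thesis
  proof cases
    case 1
    then have comp: "B \<in> connected_components (with_proj T \<restriction> fixed_nodes T M c)"
      by (simp add: fixed_blocks_def)
    show ?thesis
      using 1 subsetD[OF induced_component_verts[OF comp] assms(2)]
        induced_component_out_degree[OF comp assms(2)] by (rule that(1))
  next
    case 2
    then have comp: "B \<in> connected_components (with_proj T \<restriction> toggle_nodes T M c)"
      by (simp add: toggle_blocks_def)
    show ?thesis
      using 2 subsetD[OF induced_component_verts[OF comp] assms(2)]
        induced_component_out_degree[OF comp assms(2)] by (rule that(2))
  qed
qed

text \<open>Two blocks of the same kind joined by an edge of \<open>T\<close> would coincide,
  whereas an arc of the block tree joins distinct blocks.\<close>

lemma block_tree_edge_kinds:
  assumes "(u, w) \<in> block_tree_edges T M c"
  shows "u \<in> fixed_nodes T M c \<and> w \<in> toggle_nodes T M c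
    \<or> u \<in> toggle_nodes T M c \<and> w \<in> fixed_nodes T M c"
proof -
  from assms obtain B B' where e: "(u, w) \<in> parcs T" "u \<in> verts B" "w \<in> verts B'" "B \<noteq> B'"
    and B: "B \<in> pverts (block_tree T M c)" and B': "B' \<in> pverts (block_tree T M c)"
    by (auto simp: block_tree_edges_def block_tree_def Let_def)
  have fixed: "\<not> (B \<in> fixed_blocks T M c \<and> B' \<in> fixed_blocks T M c)"
    using induced_component_adjacent[OF _ _ e(2,3,1)] e(4) unfolding fixed_blocks_def by metis
  have toggle: "\<not> (B \<in> toggle_blocks T M c \<and> B' \<in> toggle_blocks T M c)"
    using induced_component_adjacent[OF _ _ e(2,3,1)] e(4) unfolding toggle_blocks_def by metis
  show ?thesis
    by (rule block_cases[OF B e(2)]; rule block_cases[OF B' e(3)]; use fixed toggle in simp)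
qed

lemma two_cycle_crossing_degree:
  assumes T: "pair_fin_digraph T"
    and M: "M \<in> {min_process T, maj_process T}"
    and c: "c \<in> two_cycles T M"
    and e: "(u, w) \<in> parcs T"
  shows "u \<in> fixed_nodes T M c \<Longrightarrow> w \<in> toggle_nodes T M c \<Longrightarrow> 2 \<le> out_degree (with_proj T) u"
    and "u \<in> toggle_nodes T M c \<Longrightarrow> w \<in> fixed_nodes T M c \<Longrightarrow> 3 \<le> out_degree (with_proj T) u"
proof -
  interpret pair_fin_digraph T by fact
  have pos: "0 < card (nbrs_in T S u)" if "w \<in> S" for S
  proof -
    have "finite (nbrs_in T S u)"
      by (rule finite_subset[OF _ pair_finite_verts]) (auto simp: wellformed')
    then show ?thesis using that e by (auto simp: card_gt_0_iff)
  qed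
  show "2 \<le> out_degree (with_proj T) u" if "u \<in> fixed_nodes T M c" "w \<in> toggle_nodes T M c"
  proof (rule two_cycle_fixed_balance[OF T M c that(1)])
    fix a b p q
    assume G: "card (nbrs_in T (toggle_nodes T M c) u) = p + q"
      and deg: "out_degree (with_proj T) u = a + b + (p + q)"
      and ineq: "a + p \<le> b + q" "a + q \<le> b + p"
    have "0 < p + q" using pos[OF that(2)] unfolding G .
    \<comment> \<open>If \<open>p = q\<close>, both are at least 1; otherwise \<open>b > a\<close>,
      so \<open>b\<close> and \<open>p + q\<close> are both at least 1.\<close>
    with ineq show ?thesis unfolding deg by presburger
  qed
  show "3 \<le> out_degree (with_proj T) u" if "u \<in> toggle_nodes T M c" "w \<in> fixed_nodes T M c"
  proof (rule two_cycle_toggle_balance[OF T M c that(1)])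
    fix a b p q
    assume F: "card (nbrs_in T (fixed_nodes T M c) u) = a + b"
      and deg: "out_degree (with_proj T) u = a + b + (p + q)"
      and ineq: "b + q < a + p" "a + q < b + p"
    have "0 < a + b" using pos[OF that(2)] unfolding F .
    \<comment> \<open>If \<open>a = b\<close>, then \<open>a + b\<close> is at least 2 and
      \<open>p\<close> at least 1; otherwise \<open>p\<close> is at least 2 and \<open>a + b\<close>
      at least 1.\<close>
    with ineq show ?thesis unfolding deg by presburger
  qed
qed

theorem theorem23:
  fixes T :: "'a pair_pre_digraph"
    and M :: "('a \<Rightarrow> nat) \<Rightarrow> 'a \<Rightarrow> nat"
    and c :: "'a \<Rightarrow> nat"
    and u w :: 'a
  assumes "undirected_tree T"
    and "M \<in> {min_process T, maj_process T}"
    and "c \<in> two_cycles T M"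
    and "(u, w) \<in> block_tree_edges T M c"
  shows "(out_degree (with_proj T) u = 2 \<longrightarrow> u \<in> fixed_nodes T M c)
    \<and> (min (out_degree (with_proj T) u) (out_degree (with_proj T) w) \<ge> 2
       \<and> max (out_degree (with_proj T) u) (out_degree (with_proj T) w) \<ge> 3)
    \<and> (\<forall>T\<^sub>0 v. T\<^sub>0 \<in> pverts (block_tree T M c) \<and> v \<in> verts T\<^sub>0
         \<and> out_degree T\<^sub>0 v = 1 \<and> even (out_degree (with_proj T) v)
         \<longrightarrow> v \<in> fixed_nodes T M c \<and> T\<^sub>0 \<in> fixed_blocks T M c)
    \<and> (\<forall>T\<^sub>0 v. T\<^sub>0 \<in> pverts (block_tree T M c) \<and> verts T\<^sub>0 = {v}
         \<longrightarrow> v \<in> fixed_nodes T M c \<and> T\<^sub>0 \<in> fixed_blocks T M c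
             \<and> even (out_degree (with_proj T) v))"
proof -
  interpret undirected_tree T by fact
  have fin: "pair_fin_digraph T" ..
  let ?F = "fixed_nodes T M c" and ?G = "toggle_nodes T M c"
  let ?d = "out_degree (with_proj T)"
  have uw: "(u, w) \<in> parcs T" using assms(4) by (auto simp: block_tree_edges_def)
  then have wu: "(w, u) \<in> parcs T" using pair_sym_arcs by (auto simp: symmetric_def dest: symD)
  note kinds = block_tree_edge_kinds[OF assms(4)]
  note deg_u = two_cycle_crossing_degree[OF fin assms(2,3) uw]
    and deg_w = two_cycle_crossing_degree[OF fin assms(2,3) wu]
  \<comment> \<open>A toggle node \<open>u\<close> would have the fixed neighbour \<open>w\<close>
    and hence degree at least 3.\<close>
  have 1: "?d u = 2 \<longrightarrow> u \<in> ?F"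
    using kinds deg_u(2) by fastforce
  \<comment> \<open>One end of the edge is fixed and has degree at least 2, the other toggles and
    has degree at least 3.\<close>
  have 2: "2 \<le> min (?d u) (?d w) \<and> 3 \<le> max (?d u) (?d w)"
    using kinds deg_u deg_w by fastforce
  have 3: "v \<in> ?F \<and> B \<in> fixed_blocks T M c"
    if B: "B \<in> pverts (block_tree T M c)" "v \<in> verts B" and "out_degree B v = 1" "even (?d v)"
    for B v
  proof (rule block_cases[OF B])
    assume "v \<in> ?G" and out: "out_degree B v = card (nbrs_in T ?G v)"
    show ?thesis
    proof (rule two_cycle_toggle_balance[OF fin assms(2,3) \<open>v \<in> ?G\<close>])
      fix a b p q
      assume "card (nbrs_in T ?G v) = p + q" "?d v = a + b + (p + q)"
        "b + q < a + p" "a + q < b + p"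
      \<comment> \<open>Here \<open>p + q = 1\<close> and \<open>p > q\<close>, so
        \<open>p - q = 1\<close>, which leaves no room for a difference between \<open>a\<close> and
        \<open>b\<close>. The degree is then odd, so \<open>v\<close> cannot be a toggle
        node.\<close>
      moreover from this have "a = b" using out \<open>out_degree B v = 1\<close> by linarith
      ultimately have "?d v = 2 * a + 1"
        using out \<open>out_degree B v = 1\<close> by simp
      with \<open>even (?d v)\<close> show ?thesis by simp
    qed
  qed simp
  have 4: "v \<in> ?F \<and> B \<in> fixed_blocks T M c \<and> even (?d v)"
    if B: "B \<in> pverts (block_tree T M c)" and single: "verts B = {v}" for B v
  proof -
    have vB: "v \<in> verts B" using single by simp
    have "subgraph B (with_proj T \<restriction> S)" if "B \<in> connected_components (with_proj T \<restriction> S)" for S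
      using that by (simp add: connected_components_def pre_digraph.max_subgraph_def)
    then have "arcs B \<subseteq> parcs T \<and> wf_digraph B \<and> tail B = fst \<and> head B = snd"
      using B by (fastforce simp: block_tree_def fixed_blocks_def toggle_blocks_def subgraph_def
          compatible_def)
    \<comment> \<open>Both ends of an arc of \<open>B\<close> lie in \<open>verts B\<close>, so an
      arc would be a loop at \<open>v\<close>.\<close>
    then have "out_arcs B v = {}"
      using single pair_no_loops by (fastforce simp: wf_digraph_def)
    then have zero: "out_degree B v = 0" by (simp add: out_degree_def)
    show ?thesis
    proof (rule block_cases[OF B vB])
      assume F: "v \<in> ?F" "B \<in> fixed_blocks T M c"
        and out: "out_degree B v = card (nbrs_in T ?F v)"
      show ?thesis
      proof (rule two_cycle_fixed_balance[OF fin assms(2,3) F(1)])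
        fix a b p q
        assume "card (nbrs_in T ?F v) = a + b" "?d v = a + b + (p + q)"
          "a + p \<le> b + q" "a + q \<le> b + p"
        \<comment> \<open>With \<open>a = b = 0\<close> the two inequalities give
          \<open>p = q\<close>.\<close>
        then have "?d v = 2 * p" using out zero by simp
        with F show ?thesis by simp
      qed
    next
      assume "v \<in> ?G" and "out_degree B v = card (nbrs_in T ?G v)"
      \<comment> \<open>A toggle node needs \<open>p > q\<close>, so at least one toggle neighbour,
        which a block without arcs does not offer.\<close>
      then show ?thesis
        using zero by (elim two_cycle_toggle_balance[OF fin assms(2,3)]) simp
    qed
  qed
  show ?thesis using 1 2 3 4 by blast
qed

end
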